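(* Let $\mathcal H$ be a real Hilbert space, let $f:\mathcal H\to\mathbb R$ be a $\mathcal C^1$ convex function whose gradient is $L$-Lipschitz continuous, let $g:\mathcal H\to\mathbb R\cup\{+\infty\}$ be proper, convex and lower semicontinuous, set $\theta=f+g$, and assume $S=\operatorname{argmin}_{\mathcal H}\theta\neq\emptyset$. Let $\alpha\ge3$ and $s>0$ with $sL\in\,]0,1]$. Let $(y_k)$ and $(w_k)$ be the sequences generated by (RAPG$_\alpha$). Then $$\theta(w_k)-\min_{\mathcal H}\theta=\mathcal O\left(\frac1{k^2}\right)\quad\text{as }k\to+\infty .$$ When $\alpha>3$, $$\theta(w_k)-\min_{\mathcal H}\theta=o\left(\frac1{k^2}\right)\quad\text{as }k\to+\infty,$$ and $(y_k)$ and $(w_k)$ converge weakly in $\mathcal H$ to the same limit, which belongs to $S$.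
   Context: For $s>0$, $\operatorname{prox}_{sg}(x)=\operatorname{argmin}_{u\in\mathcal H}\{g(u)+\frac1{2s}\|u-x\|^2\}$, and the operator $T_s:\mathcal H\to\mathcal H$ is $$T_s(y)=\frac1s\Bigl(y-\operatorname{prox}_{sg}\bigl(y-s\nabla f(y)\bigr)\Bigr).$$ The Ravine accelerated proximal gradient algorithm (RAPG$_\alpha$) is the recursion, started from two arbitrary points $y_0,y_1\in\mathcal H$ and run for $k\ge1$, $$w_k=y_k-sT_s(y_k),\qquad y_{k+1}=w_k+\left(1-\tfrac{\alpha}{k+1}\right)(w_k-w_{k-1}),$$ with $w_0=y_0-sT_s(y_0)$. *)

theory Defs
  imports "HOL-Analysis.Analysis" "HOL-Library.Landau_Symbols"
begin

text \<open>
  Functions with values in the reals together with \<open>+\<infinity>\<close> are rendered as \<^typ>\<open>ereal\<close>-valued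
  functions that never take the value \<open>-\<infinity>\<close>. This is part of \<open>proper\<close>.
\<close>

definition proper :: "('a \<Rightarrow> ereal) \<Rightarrow> bool" where
  "proper g \<longleftrightarrow> (\<forall>x. g x \<noteq> -\<infinity>) \<and> (\<exists>x. g x \<noteq> \<infinity>)"

text \<open>
  In \<^typ>\<open>ereal\<close> we have \<open>0 * \<infinity> = 0\<close>, so the endpoint cases \<open>u = 0\<close> and \<open>v = 0\<close> hold trivially
  and the inequality is the usual one for functions avoiding \<open>-\<infinity>\<close>.
\<close>

definition ereal_convex :: "('a::real_vector \<Rightarrow> ereal) \<Rightarrow> bool" where
  "ereal_convex g \<longleftrightarrow>
     (\<forall>x y. \<forall>u\<ge>0. \<forall>v\<ge>0. u + v = 1 \<longrightarrow>
        g (u *\<^sub>R x + v *\<^sub>R y) \<le> ereal u * g x + ereal v * g y)"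

definition lower_semicontinuous :: "('a::topological_space \<Rightarrow> ereal) \<Rightarrow> bool" where
  "lower_semicontinuous g \<longleftrightarrow> (\<forall>x. g x \<le> Liminf (at x) g)"

definition argmin_set :: "('a \<Rightarrow> ereal) \<Rightarrow> 'a set" where
  "argmin_set \<theta> = {x. is_arg_min \<theta> (\<lambda>_. True) x}"

text \<open>
  \<open>prox s g\<close> is the proximal operator of \<open>s g\<close>. For proper convex lower semicontinuous \<open>g\<close> on
  a Hilbert space and \<open>s > 0\<close> the minimiser exists and is unique, so the choice made by
  \<^const>\<open>arg_min\<close> is immaterial.
\<close>

definition prox :: "real \<Rightarrow> ('a::real_inner \<Rightarrow> ereal) \<Rightarrow> 'a \<Rightarrow> 'a" where
  "prox s g x = arg_min (\<lambda>u. g u + ereal (1 / (2 * s) * (norm (u - x))\<^sup>2)) (\<lambda>_. True)"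

text \<open>The argument \<open>gradf\<close> stands for the gradient of the smooth part \<open>f\<close>.\<close>

definition T_op :: "real \<Rightarrow> ('a::real_inner \<Rightarrow> 'a) \<Rightarrow> ('a \<Rightarrow> ereal) \<Rightarrow> 'a \<Rightarrow> 'a" where
  "T_op s gradf g y = (1 / s) *\<^sub>R (y - prox s g (y - s *\<^sub>R gradf y))"

text \<open>The starting points \<open>y 0\<close> and \<open>y 1\<close> are unconstrained.\<close>

definition RAPG :: "real \<Rightarrow> real \<Rightarrow> ('a::real_inner \<Rightarrow> 'a) \<Rightarrow> ('a \<Rightarrow> ereal)
    \<Rightarrow> (nat \<Rightarrow> 'a) \<Rightarrow> (nat \<Rightarrow> 'a) \<Rightarrow> bool" where
  "RAPG \<alpha> s gradf g y w \<longleftrightarrow>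
     w 0 = y 0 - s *\<^sub>R T_op s gradf g (y 0) \<and>
     (\<forall>k\<ge>1. w k = y k - s *\<^sub>R T_op s gradf g (y k) \<and>
            y (k + 1) = w k + (1 - \<alpha> / (real k + 1)) *\<^sub>R (w k - w (k - 1)))"

text \<open>
  Weak convergence in a real Hilbert space, with the continuous linear functionals given as
  \<open>x \<mapsto> inner x v\<close>.
\<close>

definition weakly_converges :: "(nat \<Rightarrow> 'a::real_inner) \<Rightarrow> 'a \<Rightarrow> bool" where
  "weakly_converges x l \<longleftrightarrow> (\<forall>v. (\<lambda>k. inner (x k) v) \<longlonglongrightarrow> inner l v)"

end

theory Submission
  imports Defs
begin

text \<open>
  Everything rests on one inequality for a proximal gradient step \<open>w\<close> taken at \<open>y\<close>: with
  \<open>\<Phi> = 2 s \<theta>\<close>,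
  \<open>\<Phi> w + \<parallel>w - x\<parallel>\<^sup>2 \<le> \<Phi> x + \<parallel>y - x\<parallel>\<^sup>2\<close> for every \<open>x\<close> in the domain of \<open>\<theta>\<close>
  (\<open>proximal_gradient_three_point\<close>). It combines strong convexity of the proximal subproblem with
  the quadratic upper bound on \<open>f\<close> (this is where \<open>s L \<le> 1\<close> enters) and the tangent lower bound.

  Let \<open>z\<close> be a minimizer and \<open>b = \<alpha> - 1\<close>. Taking for \<open>x\<close> the convex combination
  \<open>(1 - b / (k + 1)) w\<^sub>k + (b / (k + 1)) z\<close> makes the extrapolation formula telescope: the energy
  \<open>k\<^sup>2 (\<Phi> w\<^sub>k - \<Phi> z) + \<parallel>k w\<^sub>k - (k - b) w\<^sub>k\<^sub>-\<^sub>1 - b z\<parallel>\<^sup>2\<close> decreases by at least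
  \<open>((\<alpha> - 3) (k + 1) + 1) (\<Phi> w\<^sub>k - \<Phi> z)\<close> at step \<open>k\<close> (\<open>energy_decrease\<close>). For \<open>\<alpha> \<ge> 3\<close> the
  energy is bounded, which is the rate \<open>O(1/k\<^sup>2)\<close>.

  For \<open>\<alpha> > 3\<close> the decrease is summable, so \<open>\<Sum> k (\<Phi> w\<^sub>k - \<Phi> z)\<close> is finite. Taking \<open>x = w\<^sub>k\<close>
  instead shows that \<open>F\<^sub>k = k\<^sup>2 (\<Phi> w\<^sub>k - \<Phi> z + \<parallel>w\<^sub>k - w\<^sub>k\<^sub>-\<^sub>1\<parallel>\<^sup>2)\<close> decreases up to a summable
  error, by an amount that makes \<open>\<Sum> k \<parallel>w\<^sub>k - w\<^sub>k\<^sub>-\<^sub>1\<parallel>\<^sup>2\<close> finite as well. Hence \<open>F\<close> converges while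
  \<open>\<Sum> F\<^sub>k / k\<close> is finite, so \<open>F\<close> tends to \<open>0\<close>: the gap is \<open>o(1/k\<^sup>2)\<close> and the velocity
  \<open>w\<^sub>k - w\<^sub>k\<^sub>-\<^sub>1\<close> is \<open>o(1/k)\<close>. Inserting this into the convergent energy shows that \<open>\<parallel>w\<^sub>k - z\<parallel>\<close> converges for each
  minimizer \<open>z\<close> (\<open>convergent_norm\<close>).

  Weak convergence then follows from a form of Opial's lemma without weak compactness
  (\<open>weakly_converges_of_tail_hulls\<close>). Weak cluster points are replaced by points that lie in the
  closed convex hull of every tail. Such points exist because nested bounded closed convex sets
  in a Hilbert space meet, they are minimizers because sublevel sets of \<open>\<Phi>\<close> are closed and
  convex, and convergence of the distances to minimizers leaves room for only one of them.

  The same intersection property gives the existence of proximal points. The affine minorant of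
  \<open>g\<close> that this needs comes from the optimality condition at a minimizer of \<open>\<theta>\<close>.
\<close>

section \<open>Convexity in real inner product spaces\<close>

lemma le_of_le_add_small_multiple:
  fixes A B C :: real
  assumes "\<And>t. 0 < t \<Longrightarrow> t \<le> 1 \<Longrightarrow> A \<le> B + t * C"
  shows "A \<le> B"
proof (rule tendsto_lowerbound)
  show "((\<lambda>t. B + t * C) \<longlongrightarrow> B) (at_right 0)"
    by (auto intro!: tendsto_eq_intros)
  show "\<forall>\<^sub>F t in at_right 0. A \<le> B + t * C"
    using eventually_at_right_less eventually_at_right_real[of 0 "1::real"] assms
    by (auto elim!: eventually_mono)
qed auto

lemma convex_sublevel:
  assumes "convex_on D \<Phi>"
  shows "convex {x \<in> D. \<Phi> x \<le> c}"
proof (rule convexI)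
  fix x y and u v :: real
  assume xy: "x \<in> {x \<in> D. \<Phi> x \<le> c}" "y \<in> {x \<in> D. \<Phi> x \<le> c}"
    and uv: "0 \<le> u" "0 \<le> v" "u + v = 1"
  then have "\<Phi> (u *\<^sub>R x + v *\<^sub>R y) \<le> u * \<Phi> x + v * \<Phi> y"
    using assms by (simp add: convex_on_def)
  also have "\<dots> \<le> c" using xy uv by (intro convex_bound_le) auto
  finally show "u *\<^sub>R x + v *\<^sub>R y \<in> {x \<in> D. \<Phi> x \<le> c}"
    using assms xy uv by (auto simp: convex_on_def intro: convexD)
qed

text \<open>
  The optimality condition \<open>- \<nabla>q(w) \<in> \<partial>G(w)\<close>, tested at \<open>x\<close>, with \<open>l\<close> in the role of the
  directional derivative of \<open>q\<close>. Move
  from \<open>w\<close> a fraction \<open>t\<close> of the way to \<open>x\<close>, divide by \<open>t\<close> and let \<open>t\<close> tend to \<open>0\<close>.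
\<close>

lemma minimizer_variational:
  fixes G q :: "'a::real_vector \<Rightarrow> real"
  assumes "convex_on D G" "w \<in> D" "x \<in> D"
    and q: "\<And>t. 0 < t \<Longrightarrow> t \<le> 1 \<Longrightarrow> q (w + t *\<^sub>R (x - w)) \<le> q w + t * l + t\<^sup>2 * C"
    and min: "\<And>u. u \<in> D \<Longrightarrow> G w + q w \<le> G u + q u"
  shows "G w \<le> G x + l"
proof (rule le_of_le_add_small_multiple)
  fix t :: real assume t: "0 < t" "t \<le> 1"
  have eq: "w + t *\<^sub>R (x - w) = (1 - t) *\<^sub>R w + t *\<^sub>R x"
    by (simp add: algebra_simps)
  have "G (w + t *\<^sub>R (x - w)) \<le> (1 - t) * G w + t * G x"
    unfolding eq using assms(1-3) t by (intro convex_onD) auto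
  moreover have "w + t *\<^sub>R (x - w) \<in> D"
    unfolding eq using assms(1-3) t by (intro convexD) (auto simp: convex_on_def)
  ultimately have "t * G w \<le> t * (G x + l + t * C)"
    using min[of "w + t *\<^sub>R (x - w)"] q[OF t] by (simp add: algebra_simps power2_eq_square)
  then show "G w \<le> G x + l + t * C" using t by simp
qed

text \<open>
  This replaces weak compactness of bounded closed convex sets. Near-minimizers of the norm on
  the sets \<open>C n\<close> form a Cauchy sequence by the parallelogram law, since the midpoint of two of
  them lies in the larger of the two sets and cannot have a much smaller norm.
\<close>

lemma nested_closed_convex_Inter:
  fixes C :: "nat \<Rightarrow> 'a::{real_inner, complete_space} set"
  assumes ne: "\<And>n. C n \<noteq> {}" and cl: "\<And>n. closed (C n)" and cv: "\<And>n. convex (C n)"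
    and bd: "bounded (C 0)" and dec: "\<And>m n. m \<le> n \<Longrightarrow> C n \<subseteq> C m"
  shows "\<exists>p. \<forall>n. p \<in> C n"
proof -
  define d where "d n = Inf ((\<lambda>x. (norm x)\<^sup>2) ` C n)" for n
  have bb: "bdd_below ((\<lambda>x. (norm x)\<^sup>2) ` A)" for A :: "'a set"
    by (rule bdd_belowI[of _ 0]) auto
  have dle: "d n \<le> (norm x)\<^sup>2" if "x \<in> C n" for x n
    unfolding d_def using that bb by (intro cInf_lower) auto
  obtain B where B: "\<And>x. x \<in> C 0 \<Longrightarrow> norm x \<le> B"
    using bd by (auto simp: bounded_iff)
  have "incseq d"
    unfolding incseq_def d_def using dec ne bb
    by (intro allI impI cInf_superset_mono) auto
  moreover have "d n \<le> B\<^sup>2" for n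
  proof -
    obtain x where "x \<in> C n" using ne by blast
    then have "norm x \<le> B" using B dec[of 0 n] by auto
    then have "(norm x)\<^sup>2 \<le> B\<^sup>2" by (simp add: power_mono)
    then show ?thesis using dle[OF \<open>x \<in> C n\<close>] by linarith
  qed
  ultimately obtain e where e: "d \<longlonglongrightarrow> e" "\<And>n. d n \<le> e"
    using incseq_convergent by metis
  have "\<exists>x. x \<in> C n \<and> (norm x)\<^sup>2 < d n + 1 / (real n + 1)" for n
  proof -
    have "\<exists>v\<in>(\<lambda>x. (norm x)\<^sup>2) ` C n. v < d n + 1 / (real n + 1)"
      using ne bb unfolding d_def by (intro cInf_lessD) auto
    then show ?thesis by auto
  qed
  then obtain x where xC: "\<And>n. x n \<in> C n" and xd: "\<And>n. (norm (x n))\<^sup>2 < d n + 1 / (real n + 1)"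
    by metis
  have gap: "(norm (x m - x n))\<^sup>2 \<le> 2 * (e - d m) + 4 / (real m + 1)" if "m \<le> n" for m n
  proof -
    have "(1/2) *\<^sub>R x m + (1/2) *\<^sub>R x n \<in> C m"
      using xC dec[OF that] by (intro convexD[OF cv]) auto
    from dle[OF this] have "4 * d m \<le> (norm (x m + x n))\<^sup>2"
      by (simp add: scaleR_add_right[symmetric] power_divide power_mult_distrib)
    moreover have "(norm (x m - x n))\<^sup>2 = 2 * (norm (x m))\<^sup>2 + 2 * (norm (x n))\<^sup>2 - (norm (x m + x n))\<^sup>2"
      by (simp add: power2_norm_eq_inner algebra_simps inner_commute)
    moreover have "1 / (real n + 1) \<le> 1 / (real m + 1)" using that by (simp add: field_simps)
    ultimately show ?thesis using xd[of m] xd[of n] e(2)[of n] by simp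
  qed
  have "(\<lambda>m. 2 * (e - d m) + 4 * inverse (real (Suc m))) \<longlonglongrightarrow> 2 * (e - e) + 4 * 0"
    by (intro tendsto_intros e LIMSEQ_inverse_real_of_nat)
  then have lim: "(\<lambda>m. 2 * (e - d m) + 4 / (real m + 1)) \<longlonglongrightarrow> 0" by (simp add: field_simps)
  have "Cauchy x"
  proof (rule metric_CauchyI)
    fix r :: real assume "r > 0"
    then have "\<forall>\<^sub>F m in sequentially. 2 * (e - d m) + 4 / (real m + 1) < (r/2)\<^sup>2"
      using lim by (intro order_tendstoD) auto
    then obtain M where M: "2 * (e - d M) + 4 / (real M + 1) < (r/2)\<^sup>2"
      by (auto simp: eventually_sequentially)
    have *: "norm (x M - x n) < r/2" if "M \<le> n" for n
      using gap[OF that] M \<open>r > 0\<close> by (intro power2_less_imp_less[of _ "r/2"]) auto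
    show "\<exists>M. \<forall>m\<ge>M. \<forall>n\<ge>M. dist (x m) (x n) < r"
      by (rule exI[of _ M]) (metis * dist_norm dist_triangle_half_r)
  qed
  then obtain p where p: "x \<longlonglongrightarrow> p" using Cauchy_convergent convergent_def by blast
  have "p \<in> C n" for n
    using cl[of n] _ _ p
  proof (rule Lim_in_closed_set)
    show "\<forall>\<^sub>F m in sequentially. x m \<in> C n"
      using eventually_ge_at_top[of n] by eventually_elim (use xC dec in blast)
  qed auto
  then show ?thesis by blast
qed

section \<open>Weak convergence from the convex hulls of the tails\<close>

text \<open>
  A closed slab that contains a tail of the sequence also contains the closed convex hull of
  that tail.
\<close>

lemma inner_of_tail_hulls:
  fixes w :: "nat \<Rightarrow> 'a::real_inner"
  assumes "(\<lambda>k. inner (w k) d) \<longlonglongrightarrow> l"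
    and p: "\<And>n. p \<in> closure (convex hull (w ` {n..}))"
  shows "inner p d = l"
proof -
  have "\<bar>inner p d - l\<bar> \<le> \<epsilon>" if \<epsilon>: "\<epsilon> > 0" for \<epsilon>
  proof -
    let ?H = "{x. inner d x \<le> l + \<epsilon>} \<inter> {x. inner d x \<ge> l - \<epsilon>}"
    obtain n where n: "\<And>k. k \<ge> n \<Longrightarrow> \<bar>inner (w k) d - l\<bar> < \<epsilon>"
      using LIMSEQ_D[OF assms(1) \<epsilon>] by auto
    have "closure (convex hull (w ` {n..})) \<subseteq> ?H"
    proof (intro closure_minimal hull_minimal closed_Int closed_halfspace_le closed_halfspace_ge
        convex_Int convex_halfspace_le convex_halfspace_ge)
      show "w ` {n..} \<subseteq> ?H" using n by (force simp: inner_commute abs_less_iff)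
    qed
    then show ?thesis using p[of n] by (auto simp: inner_commute abs_le_iff)
  qed
  then show ?thesis using dense_eq0_I[of "inner p d - l"] by simp
qed

text \<open>
  A variant of Opial's lemma. For two points \<open>p\<close>, \<open>q\<close> in all the tail hulls, convergence of
  \<open>\<parallel>w\<^sub>k - p\<parallel>\<close> and \<open>\<parallel>w\<^sub>k - q\<parallel>\<close> makes \<open>\<langle>w\<^sub>k, p - q\<rangle>\<close> converge, and its limit equals both
  \<open>\<langle>p, p - q\<rangle>\<close> and \<open>\<langle>q, p - q\<rangle>\<close>; so \<open>p = q\<close>. If \<open>w\<close> did not converge weakly to this point, the
  terms that stay on the wrong side of some hyperplane would produce a second one.
\<close>

lemma weakly_converges_of_tail_hulls:
  fixes w :: "nat \<Rightarrow> 'a::{real_inner, complete_space}"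
  assumes bd: "bounded (range w)"
    and S: "\<And>p. (\<And>n. p \<in> closure (convex hull (w ` {n..}))) \<Longrightarrow> p \<in> S"
    and conv: "\<And>z. z \<in> S \<Longrightarrow> convergent (\<lambda>k. (norm (w k - z))\<^sup>2)"
  shows "\<exists>x\<in>S. weakly_converges w x"
proof -
  have ex: "\<exists>p. \<forall>n. p \<in> closure (convex hull (w ` {k\<in>A. n \<le> k}))" if "infinite A" for A
  proof (rule nested_closed_convex_Inter)
    fix n
    have "{k\<in>A. n \<le> k} \<noteq> {}" using that by (auto simp: infinite_nat_iff_unbounded_le)
    then show "closure (convex hull (w ` {k\<in>A. n \<le> k})) \<noteq> {}" by simp
  next
    show "bounded (closure (convex hull (w ` {k \<in> A. 0 \<le> k})))"
      by (rule bounded_closure, rule bounded_convex_hull) (rule bounded_subset[OF bd], auto)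
  next
    fix m n :: nat assume "m \<le> n"
    then show "closure (convex hull (w ` {k\<in>A. n \<le> k})) \<subseteq> closure (convex hull (w ` {k\<in>A. m \<le> k}))"
      by (intro closure_mono hull_mono) auto
  qed (auto intro: convex_closure)
  have sub: "p \<in> closure (convex hull (w ` {n..}))"
    if "p \<in> closure (convex hull (w ` {k\<in>A. n \<le> k}))" for p A n
    using that by (rule rev_subsetD) (intro closure_mono hull_mono, auto)
  have unique: "p = q" if pq: "\<And>n. p \<in> closure (convex hull (w ` {n..}))"
    "\<And>n. q \<in> closure (convex hull (w ` {n..}))" for p q
  proof -
    obtain a b where "(\<lambda>k. (norm (w k - p))\<^sup>2) \<longlonglongrightarrow> a" "(\<lambda>k. (norm (w k - q))\<^sup>2) \<longlonglongrightarrow> b"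
      using conv[OF S[OF pq(1)]] conv[OF S[OF pq(2)]] unfolding convergent_def by blast
    then have "(\<lambda>k. ((norm (w k - q))\<^sup>2 - (norm (w k - p))\<^sup>2 + (norm p)\<^sup>2 - (norm q)\<^sup>2) / 2)
      \<longlonglongrightarrow> (b - a + (norm p)\<^sup>2 - (norm q)\<^sup>2) / 2"
      by (intro tendsto_intros) auto
    moreover have "(\<lambda>k. ((norm (w k - q))\<^sup>2 - (norm (w k - p))\<^sup>2 + (norm p)\<^sup>2 - (norm q)\<^sup>2) / 2)
       = (\<lambda>k. inner (w k) (p - q))"
      by (auto simp: power2_norm_eq_inner algebra_simps inner_commute diff_divide_distrib)
    ultimately have l: "(\<lambda>k. inner (w k) (p - q)) \<longlonglongrightarrow> (b - a + (norm p)\<^sup>2 - (norm q)\<^sup>2) / 2" by simp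
    have "inner p (p - q) = inner q (p - q)"
      using inner_of_tail_hulls[OF l pq(1)] inner_of_tail_hulls[OF l pq(2)] by simp
    then have "inner (p - q) (p - q) = 0" by (simp add: inner_diff_left)
    then show ?thesis by simp
  qed
  obtain p where "\<And>n. p \<in> closure (convex hull (w ` {k\<in>UNIV. n \<le> k}))"
    using ex[of UNIV] by auto
  then have p: "\<And>n. p \<in> closure (convex hull (w ` {n..}))" using sub by blast
  have upper: "\<forall>\<^sub>F k in sequentially. inner (w k) v < inner p v + \<epsilon>" if "\<epsilon> > 0" for v \<epsilon>
  proof (rule ccontr)
    define A where "A = {k. inner (w k) v \<ge> inner p v + \<epsilon>}"
    assume "\<not> (\<forall>\<^sub>F k in sequentially. inner (w k) v < inner p v + \<epsilon>)"
    then have "infinite A"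
      unfolding A_def cofinite_eq_sequentially[symmetric] eventually_cofinite by (simp add: not_less)
    then obtain q where q: "\<And>n. q \<in> closure (convex hull (w ` {k\<in>A. n \<le> k}))" using ex by blast
    then have "q = p" using p sub unique by blast
    have "closure (convex hull (w ` {k\<in>A. 0 \<le> k})) \<subseteq> {x. inner v x \<ge> inner p v + \<epsilon>}"
      by (intro closure_minimal hull_minimal closed_halfspace_ge convex_halfspace_ge)
        (auto simp: A_def inner_commute)
    then have "inner v q \<ge> inner p v + \<epsilon>" using q[of 0] by auto
    then show False using that \<open>q = p\<close> by (simp add: inner_commute)
  qed
  have "weakly_converges w p"
    unfolding weakly_converges_def
  proof (intro allI order_tendstoI)
    fix v c
    show "\<forall>\<^sub>F k in sequentially. inner (w k) v < c" if "inner p v < c"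
      using upper[of "c - inner p v" v] that by simp
    show "\<forall>\<^sub>F k in sequentially. c < inner (w k) v" if "c < inner p v"
      using upper[of "inner p v - c" "- v"] that by simp
  qed
  then show ?thesis using S p by blast
qed

section \<open>Two facts on real sequences\<close>

text \<open>
  The sequence \<open>F k + (\<Sum>i<k. e i) - (\<Sum>i<k. h i)\<close> is decreasing from \<open>N\<close> on and bounded below.
\<close>

lemma quasi_decreasing:
  fixes F e h :: "nat \<Rightarrow> real"
  assumes F: "\<And>k. F k \<ge> 0" and e: "\<And>k. k \<ge> N \<Longrightarrow> e k \<ge> 0" and h: "summable h"
    and step: "\<And>k. k \<ge> N \<Longrightarrow> F (Suc k) + e k \<le> F k + h k"
  shows "summable e" and "convergent F"
proof -
  define e' h' F' where "e' k = e (k + N)" and "h' k = h (k + N)" and "F' k = F (k + N)" for k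
  have h': "summable h'" unfolding h'_def using h summable_iff_shift by blast
  define P where "P k = F' k + sum e' {..<k} - sum h' {..<k}" for k
  have "P (Suc k) \<le> P k" for k
    using step[of "k + N"] by (simp add: P_def F'_def e'_def h'_def)
  then have dec: "decseq P" by (rule decseq_SucI)
  have "convergent (\<lambda>k. sum h' {..<k})" using h' summable_iff_convergent by blast
  then have hb: "Bseq (\<lambda>k. sum h' {..<k})" by (rule convergent_imp_Bseq)
  then obtain B where B: "\<And>k. \<bar>sum h' {..<k}\<bar> \<le> B" unfolding Bseq_def by auto
  have e0: "e' k \<ge> 0" for k using e by (simp add: e'_def)
  have F0: "F' k \<ge> 0" for k using F by (simp add: F'_def)
  have es: "sum e' {..<k} \<ge> 0" for k using e0 by (simp add: sum_nonneg)
  have "sum e' {..<k} \<le> P 0 + B" for k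
    using decseqD[OF dec, of 0 k] B[of k] F0[of k] by (simp add: P_def)
  then have se': "summable e'" using e0 by (intro bounded_imp_summable[of _ "P 0 + B"])
      (simp_all only: lessThan_Suc_atMost[symmetric])
  then show "summable e" unfolding e'_def using summable_iff_shift by blast
  have "P k \<ge> - B" for k using B[of k] F0[of k] es[of k] by (simp add: P_def)
  then obtain l where l: "P \<longlonglongrightarrow> l" using decseq_convergent[OF dec] by metis
  have "(\<lambda>k. P k - sum e' {..<k} + sum h' {..<k}) \<longlonglongrightarrow> l - suminf e' + suminf h'"
    using l summable_LIMSEQ[OF se'] summable_LIMSEQ[OF h'] by (intro tendsto_intros)
  then have "F' \<longlonglongrightarrow> l - suminf e' + suminf h'" by (simp add: P_def)
  then have "F \<longlonglongrightarrow> l - suminf e' + suminf h'" unfolding F'_def by (rule LIMSEQ_offset)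
  then show "convergent F" unfolding convergent_def by blast
qed

lemma tendsto_0_of_summable_divide:
  fixes F :: "nat \<Rightarrow> real"
  assumes F: "\<And>k. F k \<ge> 0" and "convergent F" and sm: "summable (\<lambda>k. F k / real k)"
  shows "F \<longlonglongrightarrow> 0"
proof -
  obtain l where l: "F \<longlonglongrightarrow> l" using assms convergent_def by blast
  have "l = 0"
  proof (rule ccontr)
    assume "l \<noteq> 0"
    moreover have "l \<ge> 0" using F by (intro LIMSEQ_le_const[OF l]) auto
    ultimately have "l > 0" by simp
    then have "\<forall>\<^sub>F k in sequentially. l / 2 < F k" using l by (intro order_tendstoD) auto
    then have "\<forall>\<^sub>F k in sequentially. norm (inverse (of_nat k) :: real) \<le> (2 / l) * (F k / real k)"
      using eventually_gt_at_top[of 0]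
      by eventually_elim (use \<open>l > 0\<close> in \<open>simp add: field_simps\<close>)
    then have "summable (\<lambda>k. inverse (of_nat k) :: real)"
      by (rule summable_comparison_test_ev) (intro summable_mult sm)
    then show False using not_summable_harmonic[where 'a=real] by simp
  qed
  then show ?thesis using l by simp
qed

section \<open>The energy of a Ravine iteration\<close>

lemma norm_scaled_square:
  fixes a b :: "'a::real_normed_vector"
  shows "n *\<^sub>R a = b \<Longrightarrow> n\<^sup>2 * (norm a)\<^sup>2 = (norm b)\<^sup>2"
  by (auto simp: power_mult_distrib)

text \<open>
  What the energy argument uses of the algorithm: \<open>D\<close> is the domain of the objective, and \<open>\<Phi>\<close>
  is the objective scaled by \<open>2 s\<close>, so that the squared distances carry no factor.
\<close>

locale ravine_iteration =
  fixes D :: "'a::{real_inner, complete_space} set" and \<Phi> :: "'a \<Rightarrow> real"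
    and y w :: "nat \<Rightarrow> 'a" and \<alpha> :: real
  assumes convex_\<Phi>: "convex_on D \<Phi>"
    and w_in_D: "w k \<in> D"
    and three_point: "x \<in> D \<Longrightarrow> \<Phi> (w k) + (norm (w k - x))\<^sup>2 \<le> \<Phi> x + (norm (y k - x))\<^sup>2"
    and extrapolation: "k \<ge> 1 \<Longrightarrow> y (Suc k) = w k + (1 - \<alpha> / (real k + 1)) *\<^sub>R (w k - w (k - 1))"
    and alpha_ge: "\<alpha> \<ge> 3"
begin

definition minimizers :: "'a set" where
  "minimizers = {z \<in> D. \<forall>x\<in>D. \<Phi> z \<le> \<Phi> x}"

definition gap :: "'a \<Rightarrow> nat \<Rightarrow> real" where
  "gap z k = \<Phi> (w k) - \<Phi> z"

text \<open>
  This is \<open>\<alpha> - 1\<close> times the point \<open>w\<^sub>k\<^sub>-\<^sub>1 + (k / (\<alpha> - 1)) (w\<^sub>k - w\<^sub>k\<^sub>-\<^sub>1)\<close>. The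
  extrapolation is such that the momentum cancels: from \<open>k\<close> to \<open>k + 1\<close> the anchor moves by
  \<open>(k + 1) (w\<^sub>k\<^sub>+\<^sub>1 - y\<^sub>k\<^sub>+\<^sub>1)\<close>, a multiple of the proximal gradient step.
\<close>

definition anchor :: "nat \<Rightarrow> 'a" where
  "anchor k = real k *\<^sub>R w k - (real k - (\<alpha> - 1)) *\<^sub>R w (k - 1)"

definition energy :: "'a \<Rightarrow> nat \<Rightarrow> real" where
  "energy z k = (real k)\<^sup>2 * gap z k + (norm (anchor k - (\<alpha> - 1) *\<^sub>R z))\<^sup>2"

lemma gap_nonneg: "z \<in> minimizers \<Longrightarrow> gap z k \<ge> 0"
  using w_in_D[of k] by (auto simp: minimizers_def gap_def)

lemma energy_nonneg: "z \<in> minimizers \<Longrightarrow> energy z k \<ge> 0"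
  using gap_nonneg by (simp add: energy_def)

text \<open>
  The comparison point \<open>x\<close> satisfies \<open>(k + 1) (w\<^sub>k\<^sub>+\<^sub>1 - x) = anchor (k + 1) - (\<alpha> - 1) z\<close>, and the
  extrapolation formula is exactly what gives \<open>(k + 1) (y\<^sub>k\<^sub>+\<^sub>1 - x) = anchor k - (\<alpha> - 1) z\<close>. The
  bound \<open>k + 1 \<ge> \<alpha> - 1\<close> makes \<open>x\<close> a convex combination.
\<close>

lemma energy_decrease:
  assumes z: "z \<in> D" and k: "k \<ge> 1" "real k + 1 \<ge> \<alpha> - 1"
  shows "energy z (Suc k) + ((\<alpha> - 3) * (real k + 1) + 1) * gap z k \<le> energy z k"
proof -
  define n where "n = real k + 1"
  have n: "n > 0" "real (Suc k) = n" "real k = n - 1" by (simp_all add: n_def)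
  define b where "b = \<alpha> - 1"
  have b: "b > 0" "b \<le> n" using alpha_ge k by (simp_all add: b_def n_def)
  define x where "x = (1 - b / n) *\<^sub>R w k + (b / n) *\<^sub>R z"
  have bn: "0 \<le> b / n" "b / n \<le> 1" using b n(1) by simp_all
  have xD: "x \<in> D"
    unfolding x_def using bn convex_\<Phi> w_in_D z by (intro convexD) (auto simp: convex_on_def)
  have "\<Phi> x \<le> (1 - b / n) * \<Phi> (w k) + (b / n) * \<Phi> z"
    unfolding x_def using bn w_in_D z by (intro convex_onD[OF convex_\<Phi>]) auto
  then have gx: "\<Phi> x - \<Phi> z \<le> (1 - b / n) * gap z k" by (simp add: gap_def algebra_simps)
  have nx: "n *\<^sub>R x = (n - b) *\<^sub>R w k + b *\<^sub>R z"
    using n(1) by (simp add: x_def scaleR_add_right right_diff_distrib)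
  have "n *\<^sub>R (w (Suc k) - x) = anchor (Suc k) - b *\<^sub>R z"
    using n by (simp add: anchor_def scaleR_diff_right nx b_def)
  then have nw: "n\<^sup>2 * (norm (w (Suc k) - x))\<^sup>2 = (norm (anchor (Suc k) - b *\<^sub>R z))\<^sup>2"
    by (rule norm_scaled_square)
  have "n *\<^sub>R y (Suc k) = n *\<^sub>R w k + (n - \<alpha>) *\<^sub>R (w k - w (k - 1))"
    using n(1) by (simp add: extrapolation[OF k(1)] n_def[symmetric] scaleR_add_right right_diff_distrib)
  then have "n *\<^sub>R (y (Suc k) - x) = anchor k - b *\<^sub>R z"
    by (simp add: anchor_def scaleR_diff_right nx b_def n algebra_simps)
  then have ny: "n\<^sup>2 * (norm (y (Suc k) - x))\<^sup>2 = (norm (anchor k - b *\<^sub>R z))\<^sup>2"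
    by (rule norm_scaled_square)
  have "gap z (Suc k) + (norm (w (Suc k) - x))\<^sup>2 \<le> (1 - b / n) * gap z k + (norm (y (Suc k) - x))\<^sup>2"
    using three_point[OF xD, of "Suc k"] gx by (simp add: gap_def)
  then have "n\<^sup>2 * (gap z (Suc k) + (norm (w (Suc k) - x))\<^sup>2)
      \<le> n\<^sup>2 * ((1 - b / n) * gap z k + (norm (y (Suc k) - x))\<^sup>2)"
    by (intro mult_left_mono) auto
  then have "n\<^sup>2 * gap z (Suc k) + (norm (anchor (Suc k) - b *\<^sub>R z))\<^sup>2
      \<le> n\<^sup>2 * (1 - b / n) * gap z k + (norm (anchor k - b *\<^sub>R z))\<^sup>2"
    by (simp only: distrib_left nw ny mult.assoc)
  moreover have "n\<^sup>2 * (1 - b / n) = (n - 1)\<^sup>2 - ((\<alpha> - 3) * n + 1)"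
    using n(1) by (simp add: b_def power2_eq_square field_simps)
  ultimately have "n\<^sup>2 * gap z (Suc k) + (norm (anchor (Suc k) - b *\<^sub>R z))\<^sup>2
      \<le> ((n - 1)\<^sup>2 - ((\<alpha> - 3) * n + 1)) * gap z k + (norm (anchor k - b *\<^sub>R z))\<^sup>2"
    by (simp only:)
  then show ?thesis
    unfolding energy_def b_def[symmetric] n n_def[symmetric] by (simp add: algebra_simps)
qed

lemma gap_bound:
  assumes z: "z \<in> minimizers"
  shows "\<exists>C. \<forall>\<^sub>F k in sequentially. (real k)\<^sup>2 * gap z k \<le> C"
proof -
  obtain N where N: "real N \<ge> \<alpha>" using real_arch_simple by blast
  have le: "energy z k \<le> energy z N" if "k \<ge> N" for k
    using that
  proof (induction rule: dec_induct)
    case (step k)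
    have "(\<alpha> - 3) * (real k + 1) + 1 \<ge> 0" using alpha_ge by simp
    then have "((\<alpha> - 3) * (real k + 1) + 1) * gap z k \<ge> 0" using gap_nonneg[OF z] by simp
    moreover have "k \<ge> 1" "real k + 1 \<ge> \<alpha> - 1" using step N alpha_ge by linarith+
    ultimately show ?case using energy_decrease[of z k] z step by (auto simp: minimizers_def)
  qed simp
  have "(real k)\<^sup>2 * gap z k \<le> energy z N" if "k \<ge> N" for k
    using le[OF that] unfolding energy_def by (smt (verit) zero_le_power2)
  then show ?thesis unfolding eventually_sequentially by blast
qed

context
  assumes alpha_gt: "\<alpha> > 3"
begin

lemma
  assumes z: "z \<in> minimizers"
  shows summable_gap: "summable (\<lambda>k. real k * gap z k)"
    and convergent_energy: "convergent (energy z)"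
proof -
  obtain N where N: "real N \<ge> \<alpha>" using real_arch_simple by blast
  define e where "e k = ((\<alpha> - 3) * (real k + 1) + 1) * gap z k" for k
  have e: "e k \<ge> 0" for k using gap_nonneg[OF z] alpha_ge by (simp add: e_def)
  have "energy z (Suc k) + e k \<le> energy z k + 0" if "k \<ge> N" for k
  proof -
    have "k \<ge> 1" "real k + 1 \<ge> \<alpha> - 1" using that N alpha_ge by linarith+
    then show ?thesis using energy_decrease[of z k] z by (simp add: minimizers_def e_def)
  qed
  note quasi = quasi_decreasing[where F = "energy z" and e = e and h = "\<lambda>_. 0" and N = N,
      OF energy_nonneg[OF z] e summable_zero this]
  then show "convergent (energy z)" by blast
  have "norm (real k * gap z k) \<le> e k / (\<alpha> - 3)" for k
  proof -
    have "real k * (\<alpha> - 3) * gap z k \<le> e k"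
      unfolding e_def using alpha_gt gap_nonneg[OF z] by (intro mult_right_mono) (auto simp: algebra_simps)
    then show ?thesis using alpha_gt gap_nonneg[OF z, of k] by (simp add: field_simps)
  qed
  then show "summable (\<lambda>k. real k * gap z k)"
    by (intro summable_comparison_test[OF _ summable_divide[OF quasi(1)]] exI[of _ 0] allI impI)
qed

text \<open>
  Here the step inequality is tested at \<open>x = w\<^sub>k\<close>. The coefficient of \<open>\<parallel>w\<^sub>k - w\<^sub>k\<^sub>-\<^sub>1\<parallel>\<^sup>2\<close> drops from
  \<open>k\<^sup>2\<close> to \<open>(k + 1 - \<alpha>)\<^sup>2\<close>, a loss of order \<open>k\<close>, while the gap term grows only by the summable
  amount \<open>(2 k + 1) gap z k\<close>.
\<close>

lemma
  assumes z: "z \<in> minimizers"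
  shows gap_little_o: "(\<lambda>k. (real k)\<^sup>2 * gap z k) \<longlonglongrightarrow> 0"
    and velocity_little_o: "(\<lambda>k. real k * norm (w k - w (k - 1))) \<longlonglongrightarrow> 0"
proof -
  obtain N where N: "real N \<ge> \<alpha>" using real_arch_simple by blast
  define d where "d k = norm (w k - w (k - 1))" for k
  define F where "F k = (real k)\<^sup>2 * (gap z k + (d k)\<^sup>2)" for k
  have F0: "F k \<ge> 0" for k using gap_nonneg[OF z] by (simp add: F_def)
  have step: "F (Suc k) + real k * (d k)\<^sup>2 \<le> F k + 3 * (real k * gap z k)" if kN: "k \<ge> N" for k
  proof -
    define n where "n = real k + 1"
    have n: "1 + real k = n" by (simp add: n_def)
    have k: "k \<ge> 1" "n \<ge> \<alpha>" "n > 0" using that N alpha_ge by (auto simp: n_def)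
    have "n *\<^sub>R (y (Suc k) - w k) = (n - \<alpha>) *\<^sub>R (w k - w (k - 1))"
      using k by (simp add: extrapolation[OF k(1)] n_def[symmetric] right_diff_distrib)
    then have ny: "n\<^sup>2 * (norm (y (Suc k) - w k))\<^sup>2 = (n - \<alpha>)\<^sup>2 * (d k)\<^sup>2"
      using norm_scaled_square[of n _ "(n - \<alpha>) *\<^sub>R (w k - w (k - 1))"] by (simp add: d_def power_mult_distrib)
    have "gap z (Suc k) + (d (Suc k))\<^sup>2 \<le> gap z k + (norm (y (Suc k) - w k))\<^sup>2"
      using three_point[OF w_in_D[of k], of "Suc k"] by (simp add: gap_def d_def)
    then have "n\<^sup>2 * (gap z (Suc k) + (d (Suc k))\<^sup>2) \<le> n\<^sup>2 * (gap z k + (norm (y (Suc k) - w k))\<^sup>2)"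
      by (intro mult_left_mono) auto
    then have 1: "F (Suc k) \<le> n\<^sup>2 * gap z k + (n - \<alpha>)\<^sup>2 * (d k)\<^sup>2"
      by (simp add: F_def distrib_left ny n)
    (* 2 k + 1 is rounded up to 3 k, in order to match the summable sequence real k * gap z k *)
    have "n\<^sup>2 \<le> (real k)\<^sup>2 + 3 * real k"
      using k(1) by (simp add: n_def power2_eq_square algebra_simps)
    then have 2: "n\<^sup>2 * gap z k \<le> ((real k)\<^sup>2 + 3 * real k) * gap z k"
      using gap_nonneg[OF z] by (intro mult_right_mono)
    have "(n - \<alpha>)\<^sup>2 + real k = (real k)\<^sup>2 - (\<alpha> - 1) * (n - \<alpha>) - (\<alpha> - 2) * real k"
      by (simp add: n_def power2_eq_square algebra_simps)
    moreover have "(\<alpha> - 1) * (n - \<alpha>) \<ge> 0" "(\<alpha> - 2) * real k \<ge> 0" using k alpha_ge by simp_all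
    ultimately have "(n - \<alpha>)\<^sup>2 + real k \<le> (real k)\<^sup>2" by linarith
    then have 3: "((n - \<alpha>)\<^sup>2 + real k) * (d k)\<^sup>2 \<le> (real k)\<^sup>2 * (d k)\<^sup>2"
      by (intro mult_right_mono) auto
    show ?thesis using 1 2 3 by (simp add: F_def algebra_simps)
  qed
  have "real k * (d k)\<^sup>2 \<ge> 0" for k by simp
  note quasi = quasi_decreasing[where F = F and e = "\<lambda>k. real k * (d k)\<^sup>2" and N = N
      and h = "\<lambda>k. 3 * (real k * gap z k)", OF F0 this summable_mult[OF summable_gap[OF z]] step]
  have "F k / real k = real k * gap z k + real k * (d k)\<^sup>2" for k
    by (cases "k = 0") (simp_all add: F_def power2_eq_square field_simps)
  then have "summable (\<lambda>k. F k / real k)"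
    using summable_add[OF summable_gap[OF z] quasi(1)] by simp
  moreover have "convergent F" using quasi by blast
  ultimately have lim: "F \<longlonglongrightarrow> 0" using tendsto_0_of_summable_divide[of F] F0 by blast
  show "(\<lambda>k. (real k)\<^sup>2 * gap z k) \<longlonglongrightarrow> 0"
    by (rule tendsto_sandwich[OF _ _ tendsto_const lim])
      (use gap_nonneg[OF z] in \<open>auto simp: F_def distrib_left\<close>)
  have "(\<lambda>k. (real k * d k)\<^sup>2) \<longlonglongrightarrow> 0"
    by (rule tendsto_sandwich[OF _ _ tendsto_const lim])
      (use gap_nonneg[OF z] in \<open>auto simp: F_def distrib_left power_mult_distrib\<close>)
  from tendsto_real_sqrt[OF this] show "(\<lambda>k. real k * norm (w k - w (k - 1))) \<longlonglongrightarrow> 0"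
    by (simp add: d_def abs_mult)
qed

text \<open>
  Since \<open>anchor k = (\<alpha> - 1) w\<^sub>k + (k - (\<alpha> - 1)) (w\<^sub>k - w\<^sub>k\<^sub>-\<^sub>1)\<close> with velocity \<open>o(1/k)\<close> and a
  gap of \<open>o(1/k\<^sup>2)\<close>, the energy has the same limit as \<open>(\<alpha> - 1)\<^sup>2 \<parallel>w\<^sub>k - z\<parallel>\<^sup>2\<close>.
\<close>

lemma convergent_norm:
  assumes z: "z \<in> minimizers"
  shows "convergent (\<lambda>k. norm (w k - z))"
proof -
  define b where "b = \<alpha> - 1"
  have b: "b > 0" using alpha_ge by (simp add: b_def)
  define r where "r k = norm (anchor k - b *\<^sub>R z)" for k
  obtain l where l: "energy z \<longlonglongrightarrow> l" using convergent_energy[OF z] convergent_def by blast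
  have "(\<lambda>k. sqrt (energy z k - (real k)\<^sup>2 * gap z k)) \<longlonglongrightarrow> sqrt (l - 0)"
    by (intro tendsto_intros l gap_little_o z)
  then have r: "r \<longlonglongrightarrow> sqrt l" unfolding energy_def r_def b_def by simp
  have "(\<lambda>k. norm (b * norm (w k - z) - r k)) \<longlonglongrightarrow> 0"
  proof (rule tendsto_sandwich[OF _ _ tendsto_const velocity_little_o[OF z]])
    obtain N where N: "real N \<ge> b" using real_arch_simple by blast
    show "\<forall>\<^sub>F k in sequentially. norm (b * norm (w k - z) - r k) \<le> real k * norm (w k - w (k - 1))"
      using eventually_ge_at_top[of N]
    proof eventually_elim
      case (elim k)
      have "b * norm (w k - z) = norm (b *\<^sub>R (w k - z))" using b by simp
      then have "norm (b * norm (w k - z) - r k) \<le> norm (b *\<^sub>R (w k - z) - (anchor k - b *\<^sub>R z))"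
        unfolding r_def by (simp only: real_norm_def norm_triangle_ineq3)
      also have "b *\<^sub>R (w k - z) - (anchor k - b *\<^sub>R z) = - ((real k - b) *\<^sub>R (w k - w (k - 1)))"
        by (simp add: anchor_def b_def algebra_simps)
      also have "norm \<dots> = \<bar>real k - b\<bar> * norm (w k - w (k - 1))" by simp
      also have "\<dots> \<le> real k * norm (w k - w (k - 1))"
        using elim N b by (intro mult_right_mono) auto
      finally show ?case .
    qed
  qed auto
  then have "(\<lambda>k. b * norm (w k - z) - r k) \<longlonglongrightarrow> 0" by (rule tendsto_norm_zero_cancel)
  then have "(\<lambda>k. ((b * norm (w k - z) - r k) + r k) / b) \<longlonglongrightarrow> (0 + sqrt l) / b"
    using r b by (intro tendsto_intros) auto
  then have "(\<lambda>k. norm (w k - z)) \<longlonglongrightarrow> sqrt l / b" using b by simp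
  then show ?thesis by (rule convergentI)
qed

lemma weak_convergence:
  assumes closed_sublevel: "\<And>c. closed {x \<in> D. \<Phi> x \<le> c}" and "minimizers \<noteq> {}"
  shows "\<exists>x\<in>minimizers. weakly_converges y x \<and> weakly_converges w x"
proof -
  obtain z where z: "z \<in> minimizers" using assms(2) by blast
  have gap0: "gap z \<longlonglongrightarrow> 0"
  proof (rule tendsto_sandwich[OF _ _ tendsto_const gap_little_o[OF z]])
    show "\<forall>\<^sub>F k in sequentially. gap z k \<le> (real k)\<^sup>2 * gap z k"
      using eventually_ge_at_top[of 1]
    proof eventually_elim
      case (elim k)
      then have "1 \<le> (real k)\<^sup>2" by simp
      then show ?case using gap_nonneg[OF z, of k] by (simp add: mult_le_cancel_right1)
    qed
  qed (use gap_nonneg[OF z] in auto)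
  have hull_min: "p \<in> minimizers" if p: "\<And>n. p \<in> closure (convex hull (w ` {n..}))" for p
  proof -
    have sub: "p \<in> D \<and> \<Phi> p \<le> \<Phi> z + \<epsilon>" if "\<epsilon> > 0" for \<epsilon>
    proof -
      have "\<forall>\<^sub>F k in sequentially. gap z k < \<epsilon>" using gap0 that by (intro order_tendstoD)
      then obtain n where n: "\<And>k. k \<ge> n \<Longrightarrow> gap z k < \<epsilon>" by (auto simp: eventually_sequentially)
      have cvx: "convex {x \<in> D. \<Phi> x \<le> \<Phi> z + \<epsilon>}"
        using convex_\<Phi> by (rule convex_sublevel)
      have "closure (convex hull (w ` {n..})) \<subseteq> {x \<in> D. \<Phi> x \<le> \<Phi> z + \<epsilon>}"
        using n w_in_D by (intro closure_minimal hull_minimal cvx closed_sublevel)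
          (force simp: gap_def less_eq_real_def)
      then show ?thesis using p[of n] by blast
    qed
    have "\<Phi> p \<le> \<Phi> z" by (rule field_le_epsilon) (use sub in blast)
    moreover have "p \<in> D" using sub[of 1] by simp
    ultimately show ?thesis using z by (force simp: minimizers_def)
  qed
  have "Bseq (\<lambda>k. norm (w k - z))" using convergent_norm[OF z] by (rule convergent_imp_Bseq)
  then obtain R where R: "\<And>k. norm (w k - z) \<le> R" unfolding Bseq_def by auto
  have "bounded (range w)"
    unfolding bounded_def using R by (intro exI[of _ z] exI[of _ R]) (simp add: dist_norm norm_minus_commute)
  moreover have "convergent (\<lambda>k. (norm (w k - z))\<^sup>2)" if z: "z \<in> minimizers" for z
  proof -
    obtain l where "(\<lambda>k. norm (w k - z)) \<longlonglongrightarrow> l"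
      using convergent_norm[OF z] unfolding convergent_def by blast
    from tendsto_power[OF this, of 2] show ?thesis by (rule convergentI)
  qed
  ultimately obtain x where x: "x \<in> minimizers" "weakly_converges w x"
    using weakly_converges_of_tail_hulls[of w minimizers] hull_min by blast
  have "weakly_converges y x"
    unfolding weakly_converges_def
  proof
    fix v
    define \<delta> where "\<delta> k = inner (y (Suc k) - w k) v" for k
    have "\<delta> \<longlonglongrightarrow> 0"
    proof (rule Lim_null_comparison)
      have "(\<lambda>k. (1 + \<alpha>) * (real k * norm (w k - w (k - 1))) * norm v) \<longlonglongrightarrow> (1 + \<alpha>) * 0 * norm v"
        by (intro tendsto_intros velocity_little_o[OF z])
      then show "(\<lambda>k. (1 + \<alpha>) * (real k * norm (w k - w (k - 1))) * norm v) \<longlonglongrightarrow> 0" by simp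
      show "\<forall>\<^sub>F k in sequentially. norm (\<delta> k) \<le> (1 + \<alpha>) * (real k * norm (w k - w (k - 1))) * norm v"
        using eventually_ge_at_top[of 1]
      proof eventually_elim
        case (elim k)
        have a: "\<alpha> / (real k + 1) \<ge> 0" "\<alpha> / (real k + 1) \<le> \<alpha>"
          using alpha_ge by (simp_all add: field_simps)
        have "norm (y (Suc k) - w k) = \<bar>1 - \<alpha> / (real k + 1)\<bar> * norm (w k - w (k - 1))"
          by (simp add: extrapolation[OF elim])
        also have "\<dots> \<le> (1 + \<alpha>) * (real k * norm (w k - w (k - 1)))"
          using a elim by (intro mult_mono) (auto simp: mult_le_cancel_right1)
        finally have "norm (y (Suc k) - w k) * norm v \<le> (1 + \<alpha>) * (real k * norm (w k - w (k - 1))) * norm v"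
          by (rule mult_right_mono) simp
        then show ?case
          using Cauchy_Schwarz_ineq2[of "y (Suc k) - w k" v] by (simp add: \<delta>_def)
      qed
    qed
    then have "(\<lambda>k. inner (w k) v + \<delta> k) \<longlonglongrightarrow> inner x v + 0"
      using x(2) unfolding weakly_converges_def by (intro tendsto_add) auto
    then have "(\<lambda>k. inner (y (Suc k)) v) \<longlonglongrightarrow> inner x v" by (simp add: \<delta>_def inner_diff_left)
    then show "(\<lambda>k. inner (y k) v) \<longlonglongrightarrow> inner x v" by (rule LIMSEQ_imp_Suc)
  qed
  then show ?thesis using x by blast
qed

end

end

section \<open>Existence of proximal points\<close>

lemma norm_convex_combination_square:
  fixes a b :: "'a::real_inner"
  shows "(norm ((1 - t) *\<^sub>R a + t *\<^sub>R b))\<^sup>2 = (1 - t) * (norm a)\<^sup>2 + t * (norm b)\<^sup>2 - t * (1 - t) * (norm (a - b))\<^sup>2"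
  unfolding power2_norm_eq_inner by (simp add: algebra_simps inner_commute)

lemma convex_on_norm_square:
  fixes v :: "'a::real_inner"
  assumes "convex D" "c \<ge> 0"
  shows "convex_on D (\<lambda>u. c * (norm (u - v))\<^sup>2)"
proof (rule convex_onI)
  fix t :: real and x y assume t: "0 < t" "t < 1"
  have "(1 - t) *\<^sub>R x + t *\<^sub>R y - v = (1 - t) *\<^sub>R (x - v) + t *\<^sub>R (y - v)"
    by (simp add: algebra_simps)
  then have "(norm ((1 - t) *\<^sub>R x + t *\<^sub>R y - v))\<^sup>2 \<le> (1 - t) * (norm (x - v))\<^sup>2 + t * (norm (y - v))\<^sup>2"
    using t by (simp add: norm_convex_combination_square)
  from mult_left_mono[OF this assms(2)]
  show "c * (norm ((1 - t) *\<^sub>R x + t *\<^sub>R y - v))\<^sup>2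
      \<le> (1 - t) * (c * (norm (x - v))\<^sup>2) + t * (c * (norm (y - v))\<^sup>2)"
    by (simp add: algebra_simps)
qed fact

text \<open>
  The sublevel sets \<open>C n\<close> of the subproblem at heights decreasing to its infimum are nested closed
  convex sets, and every common point is a minimizer. They are bounded because an affine minorant
  of \<open>G\<close> plus the quadratic term is, after completing the square, a constant plus
  \<open>\<parallel>u - p\<parallel>\<^sup>2 / (2 s)\<close>.
\<close>

lemma proximal_point_exists:
  fixes G :: "'a::{real_inner, complete_space} \<Rightarrow> real" and v :: 'a
  assumes G: "convex_on D G" "D \<noteq> {}" and s: "s > 0"
    and cl: "\<And>c. closed {u \<in> D. G u + 1 / (2 * s) * (norm (u - v))\<^sup>2 \<le> c}"
    and minorant: "\<And>u. u \<in> D \<Longrightarrow> c0 + inner a u \<le> G u"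
  shows "\<exists>w\<in>D. \<forall>u\<in>D. G w + 1 / (2 * s) * (norm (w - v))\<^sup>2 \<le> G u + 1 / (2 * s) * (norm (u - v))\<^sup>2"
proof -
  define h where "h u = G u + 1 / (2 * s) * (norm (u - v))\<^sup>2" for u
  define p K where "p = v - s *\<^sub>R a" and "K = c0 + inner a v - s / 2 * (norm a)\<^sup>2"
  have coercive: "K + 1 / (2 * s) * (norm (u - p))\<^sup>2 \<le> h u" if "u \<in> D" for u
  proof -
    have "K + 1 / (2 * s) * (norm (u - p))\<^sup>2 = c0 + inner a u + 1 / (2 * s) * (norm (u - v))\<^sup>2"
    proof -
      have "u - p = (u - v) + s *\<^sub>R a" by (simp add: p_def)
      then have "(norm (u - p))\<^sup>2 = (norm (u - v))\<^sup>2 + 2 * s * inner a (u - v) + s\<^sup>2 * (norm a)\<^sup>2"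
        by (simp only: power2_norm_eq_inner) (simp add: inner_add inner_commute power2_eq_square algebra_simps)
      then show ?thesis
        using s by (simp add: K_def inner_diff_right power2_eq_square field_simps)
    qed
    then show ?thesis using minorant[OF that] by (simp add: h_def)
  qed
  have bb: "bdd_below (h ` D)"
    using coercive s by (intro bdd_belowI[of _ K]) (force intro: order_trans[rotated])
  define m where "m = Inf (h ` D)"
  define C where "C n = {u \<in> D. h u \<le> m + 1 / (real n + 1)}" for n
  have h: "convex_on D h"
    unfolding h_def using G s by (intro convex_on_add convex_on_norm_square) (auto simp: convex_on_def)
  have "\<exists>q. \<forall>n. q \<in> C n"
  proof (rule nested_closed_convex_Inter)
    fix n
    have "\<exists>v\<in>h ` D. v < m + 1 / (real n + 1)"
      using bb G(2) unfolding m_def by (intro cInf_lessD) auto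
    then show "C n \<noteq> {}" by (auto simp: C_def intro: less_imp_le)
    show "closed (C n)" unfolding C_def h_def by (rule cl)
    show "convex (C n)" unfolding C_def using h by (rule convex_sublevel)
  next
    have "norm (p - u) \<le> sqrt (2 * s * (m + 1 - K))" if "u \<in> C 0" for u
    proof -
      have "1 / (2 * s) * (norm (u - p))\<^sup>2 \<le> m + 1 - K"
        using that coercive[of u] by (simp add: C_def)
      then have "(norm (u - p))\<^sup>2 \<le> 2 * s * (m + 1 - K)" using s by (simp add: field_simps)
      then show ?thesis by (simp add: real_le_rsqrt norm_minus_commute)
    qed
    then show "bounded (C 0)" unfolding bounded_def dist_norm by blast
  next
    fix i j :: nat assume "i \<le> j"
    then have "1 / (real j + 1) \<le> 1 / (real i + 1)" by (simp add: field_simps)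
    then show "C j \<subseteq> C i" by (auto simp: C_def)
  qed
  then obtain q where q: "\<And>n. q \<in> C n" by blast
  have "h q \<le> m"
  proof (rule LIMSEQ_le_const)
    show "(\<lambda>n. m + 1 / (real n + 1)) \<longlonglongrightarrow> m"
      using tendsto_add[OF tendsto_const[of m] LIMSEQ_inverse_real_of_nat] by (simp add: field_simps)
    show "\<exists>N. \<forall>n\<ge>N. h q \<le> m + 1 / (real n + 1)" using q by (auto simp: C_def)
  qed
  then have "h q \<le> h u" if "u \<in> D" for u
    using that bb cInf_lower[of "h u" "h ` D"] by (auto simp: m_def)
  then show ?thesis using q[of 0] unfolding h_def C_def by blast
qed

section \<open>The proximal gradient step\<close>

lemma DERIV_along_line:
  fixes f :: "'a::real_inner \<Rightarrow> real"
  assumes "\<And>x. GDERIV f x :> gradf x"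
  shows "((\<lambda>t. f (y + t *\<^sub>R d)) has_real_derivative inner (gradf (y + t *\<^sub>R d)) d) (at t)"
proof -
  have "((\<lambda>t. y + t *\<^sub>R d) has_derivative (\<lambda>h. h *\<^sub>R d)) (at t)"
    by (auto intro!: derivative_eq_intros)
  moreover have "(f has_derivative (\<lambda>h. inner h (gradf (y + t *\<^sub>R d)))) (at (y + t *\<^sub>R d))"
    using assms by (simp add: gderiv_def)
  ultimately have "((\<lambda>t. f (y + t *\<^sub>R d)) has_derivative (\<lambda>h. inner (h *\<^sub>R d) (gradf (y + t *\<^sub>R d)))) (at t)"
    by (rule has_derivative_compose)
  moreover have "(\<lambda>h. inner (h *\<^sub>R d) (gradf (y + t *\<^sub>R d))) = (*) (inner (gradf (y + t *\<^sub>R d)) d)"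
    by (auto simp: inner_commute)
  ultimately show ?thesis by (simp add: has_field_derivative_def)
qed

lemma convex_above_tangent:
  fixes f :: "'a::real_inner \<Rightarrow> real"
  assumes cv: "convex_on UNIV f" and gd: "\<And>x. GDERIV f x :> gradf x"
  shows "f y + inner (gradf y) (x - y) \<le> f x"
proof -
  define \<phi> where "\<phi> t = f (y + t *\<^sub>R (x - y))" for t
  have "convex_on UNIV \<phi>"
  proof (rule convex_onI)
    fix t a b :: real assume t: "0 < t" "t < 1"
    have "y + ((1 - t) *\<^sub>R a + t *\<^sub>R b) *\<^sub>R (x - y)
        = (1 - t) *\<^sub>R (y + a *\<^sub>R (x - y)) + t *\<^sub>R (y + b *\<^sub>R (x - y))"
      by (simp add: algebra_simps)
    then show "\<phi> ((1 - t) *\<^sub>R a + t *\<^sub>R b) \<le> (1 - t) * \<phi> a + t * \<phi> b"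
      using t convex_onD[OF cv, of t] by (simp add: \<phi>_def)
  qed simp
  moreover have "(\<phi> has_real_derivative inner (gradf y) (x - y)) (at 0)"
    using DERIV_along_line[OF gd, of y "x - y" 0] by (simp add: \<phi>_def[abs_def])
  ultimately have "\<phi> 1 - \<phi> 0 \<ge> inner (gradf y) (x - y) * (1 - 0)"
    by (intro convex_on_imp_above_tangent[of UNIV]) auto
  then show ?thesis by (simp add: \<phi>_def)
qed

text \<open>
  Along the segment, the difference of the two sides has a derivative of constant sign, by the
  Cauchy-Schwarz inequality and the Lipschitz bound on the gradient.
\<close>

lemma descent_lemma:
  fixes f :: "'a::real_inner \<Rightarrow> real"
  assumes gd: "\<And>x. GDERIV f x :> gradf x" and lip: "L-lipschitz_on UNIV gradf"
  shows "f (y + d) \<le> f y + inner (gradf y) d + L / 2 * (norm d)\<^sup>2"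
proof -
  define \<phi> where "\<phi> t = f (y + t *\<^sub>R d) - t * inner (gradf y) d - L / 2 * t\<^sup>2 * (norm d)\<^sup>2" for t
  have "\<phi> 1 \<le> \<phi> 0"
  proof (rule DERIV_nonpos_imp_nonincreasing[of 0 1 \<phi>])
    fix t :: real assume t: "0 \<le> t" "t \<le> 1"
    let ?D = "inner (gradf (y + t *\<^sub>R d)) d - inner (gradf y) d - L * t * (norm d)\<^sup>2"
    have "(\<phi> has_real_derivative ?D) (at t)"
      unfolding \<phi>_def by (rule derivative_eq_intros DERIV_along_line gd refl | simp)+
    moreover have "inner (gradf (y + t *\<^sub>R d) - gradf y) d \<le> L * t * (norm d)\<^sup>2"
    proof -
      have "inner (gradf (y + t *\<^sub>R d) - gradf y) d \<le> norm (gradf (y + t *\<^sub>R d) - gradf y) * norm d"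
        by (rule norm_cauchy_schwarz)
      also have "\<dots> \<le> (L * norm (t *\<^sub>R d)) * norm d"
        using lipschitz_onD[OF lip, of "y + t *\<^sub>R d" y]
        by (intro mult_right_mono) (auto simp: dist_norm)
      finally show ?thesis using t by (simp add: power2_eq_square mult.assoc)
    qed
    ultimately show "\<exists>y. (\<phi> has_real_derivative y) (at t) \<and> y \<le> 0"
      by (intro exI[of _ ?D]) (simp add: inner_diff_left)
  qed simp
  then show ?thesis by (simp add: \<phi>_def)
qed

text \<open>
  The variational inequality of the subproblem bounds \<open>G w\<close>, the descent lemma bounds \<open>f w\<close> from
  above by its expansion at \<open>y\<close>, and convexity bounds \<open>f x\<close> from below by its tangent at \<open>y\<close>. In
  the sum the gradient terms cancel and the three-point identity
  \<open>\<parallel>w - y\<parallel>\<^sup>2 + 2 \<langle>w - y, x - w\<rangle> = \<parallel>y - x\<parallel>\<^sup>2 - \<parallel>w - x\<parallel>\<^sup>2\<close> remains.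
\<close>

lemma proximal_gradient_three_point:
  fixes f :: "'a::real_inner \<Rightarrow> real"
  assumes f: "convex_on UNIV f" "\<And>x. GDERIV f x :> gradf x" "L-lipschitz_on UNIV gradf"
    and G: "convex_on D G" and s: "s > 0" "s * L \<le> 1"
    and v: "v = y - s *\<^sub>R gradf y"
    and w: "w \<in> D" "\<And>u. u \<in> D \<Longrightarrow> G w + 1 / (2 * s) * (norm (w - v))\<^sup>2 \<le> G u + 1 / (2 * s) * (norm (u - v))\<^sup>2"
    and x: "x \<in> D"
  shows "2 * s * (f w + G w) + (norm (w - x))\<^sup>2 \<le> 2 * s * (f x + G x) + (norm (y - x))\<^sup>2"
proof -
  have "G w \<le> G x + inner (w - v) (x - w) / s"
  proof (rule minimizer_variational[OF G w(1) x _ w(2)])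
    fix t :: real
    have "(norm (w + t *\<^sub>R (x - w) - v))\<^sup>2
        = (norm (w - v))\<^sup>2 + 2 * (t * inner (w - v) (x - w)) + t\<^sup>2 * (norm (x - w))\<^sup>2"
      unfolding power2_norm_eq_inner by (simp add: inner_diff inner_add power2_eq_square inner_commute algebra_simps)
    then show "1 / (2 * s) * (norm (w + t *\<^sub>R (x - w) - v))\<^sup>2
      \<le> 1 / (2 * s) * (norm (w - v))\<^sup>2 + t * (inner (w - v) (x - w) / s)
        + t\<^sup>2 * (1 / (2 * s) * (norm (x - w))\<^sup>2)"
      using s(1) by (simp add: field_simps)
  qed
  then have "2 * s * G w \<le> 2 * s * G x + 2 * inner (w - v) (x - w)"
    using s(1) by (simp add: field_simps)
  moreover have "2 * s * f w \<le> 2 * s * f y + 2 * s * inner (gradf y) (w - y) + (norm (w - y))\<^sup>2"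
  proof -
    have "s * L * (norm (w - y))\<^sup>2 \<le> 1 * (norm (w - y))\<^sup>2"
      using s(2) by (intro mult_right_mono) auto
    moreover have "2 * s * f w \<le> 2 * s * (f y + inner (gradf y) (w - y) + L / 2 * (norm (w - y))\<^sup>2)"
      using descent_lemma[OF f(2,3), of y "w - y"] s(1) by (intro mult_left_mono) auto
    ultimately show ?thesis by (simp add: algebra_simps)
  qed
  moreover have "2 * s * (f y + inner (gradf y) (x - y)) \<le> 2 * s * f x"
    using convex_above_tangent[OF f(1,2)] s(1) by (intro mult_left_mono) auto
  moreover have "2 * inner (w - v) (x - w) + 2 * s * inner (gradf y) (w - y) + (norm (w - y))\<^sup>2
      = 2 * s * inner (gradf y) (x - y) + (norm (y - x))\<^sup>2 - (norm (w - x))\<^sup>2"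
    unfolding v power2_norm_eq_inner by (simp add: inner_diff inner_add inner_commute algebra_simps)
  ultimately show ?thesis by (simp add: distrib_left)
qed

section \<open>From extended real values to real values on the domain\<close>

lemma closed_sublevel_of_lsc:
  fixes g :: "'a::metric_space \<Rightarrow> ereal"
  assumes lsc: "lower_semicontinuous g" and ninf: "\<And>x. g x \<noteq> -\<infinity>" and q: "continuous_on UNIV q"
  shows "closed {x. g x \<noteq> \<infinity> \<and> real_of_ereal (g x) + q x \<le> c}"
  unfolding closed_sequential_limits
proof (intro allI impI, elim conjE)
  fix X l
  assume X: "\<forall>n. X n \<in> {x. g x \<noteq> \<infinity> \<and> real_of_ereal (g x) + q x \<le> c}" and l: "X \<longlonglongrightarrow> l"
  have "g l \<le> ereal (c - q l)"
  proof (rule ccontr)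
    assume "\<not> ?thesis"
    then have "ereal (c - q l) < g l" by simp
    then obtain r where r: "c - q l < r" "ereal r < g l"
      using ereal_dense2[of "ereal (c - q l)" "g l"] by auto
    then have "ereal r < Liminf (at l) g"
      using lsc by (metis lower_semicontinuous_def order_less_le_trans)
    then have "\<forall>\<^sub>F x in at l. ereal r < g x" by (rule less_LiminfD)
    then have "\<forall>\<^sub>F x in nhds l. ereal r < g x"
      using r(2) by (auto simp: eventually_at_filter elim: eventually_mono)
    then have "\<forall>\<^sub>F n in sequentially. ereal r < g (X n)"
      using l unfolding filterlim_iff by blast
    moreover have "\<forall>\<^sub>F n in sequentially. c - r < q (X n)"
    proof (rule order_tendstoD(1))
      show "(\<lambda>n. q (X n)) \<longlonglongrightarrow> q l"
        using q l by (auto intro: continuous_on_tendsto_compose)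
      show "c - r < q l" using r(1) by simp
    qed
    ultimately have "\<forall>\<^sub>F n in sequentially. False"
    proof eventually_elim
      case (elim n)
      have "r < real_of_ereal (g (X n))"
        using elim(1) X ninf[of "X n"] by (cases "g (X n)") auto
      then show ?case using elim(2) X by (smt (verit) mem_Collect_eq)
    qed
    then show False by simp
  qed
  then show "l \<in> {x. g x \<noteq> \<infinity> \<and> real_of_ereal (g x) + q x \<le> c}"
    using ninf[of l] by (cases "g l") auto
qed

lemma convex_on_domain:
  assumes cv: "ereal_convex g" and ninf: "\<And>x. g x \<noteq> -\<infinity>"
  shows "convex_on {x. g x \<noteq> \<infinity>} (\<lambda>x. real_of_ereal (g x))"
proof -
  have *: "g (u *\<^sub>R x + v *\<^sub>R y) \<noteq> \<infinity> \<and>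
      real_of_ereal (g (u *\<^sub>R x + v *\<^sub>R y)) \<le> u * real_of_ereal (g x) + v * real_of_ereal (g y)"
    if xy: "g x \<noteq> \<infinity>" "g y \<noteq> \<infinity>" and uv: "0 \<le> u" "0 \<le> v" "u + v = 1" for x y and u v :: real
  proof -
    obtain a b where ab: "g x = ereal a" "g y = ereal b"
      using xy ninf[of x] ninf[of y] by (cases "g x"; cases "g y") auto
    have "g (u *\<^sub>R x + v *\<^sub>R y) \<le> ereal (u * a + v * b)"
      using cv uv unfolding ereal_convex_def by (metis ab plus_ereal.simps(1) times_ereal.simps(1))
    then show ?thesis
      using ab ninf[of "u *\<^sub>R x + v *\<^sub>R y"] by (cases "g (u *\<^sub>R x + v *\<^sub>R y)") auto
  qed
  show ?thesis
    unfolding convex_on_def by (auto intro!: convexI simp: *)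
qed

text \<open>
  \<^const>\<open>arg_min\<close> picks an arbitrary value unless a minimizer exists, hence the assumption \<open>ex\<close>.
\<close>

lemma prox_characterization:
  fixes g :: "'a::real_inner \<Rightarrow> ereal"
  assumes ninf: "\<And>x. g x \<noteq> -\<infinity>" and D: "D = {x. g x \<noteq> \<infinity>}" and G: "G = (\<lambda>x. real_of_ereal (g x))"
    and ex: "\<exists>w\<in>D. \<forall>u\<in>D. G w + 1 / (2 * s) * (norm (w - v))\<^sup>2 \<le> G u + 1 / (2 * s) * (norm (u - v))\<^sup>2"
  shows "prox s g v \<in> D"
    and "u \<in> D \<Longrightarrow> G (prox s g v) + 1 / (2 * s) * (norm (prox s g v - v))\<^sup>2 \<le> G u + 1 / (2 * s) * (norm (u - v))\<^sup>2"
proof -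
  define h where "h u = g u + ereal (1 / (2 * s) * (norm (u - v))\<^sup>2)" for u
  have hD: "h u = ereal (G u + 1 / (2 * s) * (norm (u - v))\<^sup>2)" if "u \<in> D" for u
    using that ninf[of u] by (cases "g u") (auto simp: D G h_def)
  have hnD: "h u = \<infinity>" if "u \<notin> D" for u using that by (simp add: D h_def)
  obtain w where w: "w \<in> D"
    "\<And>u. u \<in> D \<Longrightarrow> G w + 1 / (2 * s) * (norm (w - v))\<^sup>2 \<le> G u + 1 / (2 * s) * (norm (u - v))\<^sup>2"
    using ex by blast
  have "h w \<le> h u" for u
    using w hD hnD by (cases "u \<in> D") auto
  then have "is_arg_min h (\<lambda>_. True) w" by (simp add: is_arg_min_def not_less)
  then have "is_arg_min h (\<lambda>_. True) (prox s g v)"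
    unfolding prox_def arg_min_def h_def by (rule someI)
  then have min: "h (prox s g v) \<le> h u" for u by (simp add: is_arg_min_def not_less)
  show "prox s g v \<in> D"
    using min[of w] hD[OF w(1)] hnD[of "prox s g v"] by fastforce
  then show "u \<in> D \<Longrightarrow> G (prox s g v) + 1 / (2 * s) * (norm (prox s g v - v))\<^sup>2 \<le> G u + 1 / (2 * s) * (norm (u - v))\<^sup>2"
    using min[of u] hD by simp
qed

section \<open>Convergence of the accelerated proximal gradient method\<close>

theorem theorem6p1:
  fixes f :: "'a::{real_inner, complete_space} \<Rightarrow> real"
    and gradf :: "'a \<Rightarrow> 'a"
    and g \<theta> :: "'a \<Rightarrow> ereal"
    and L \<alpha> s :: real
    and y w :: "nat \<Rightarrow> 'a"
  assumes f_convex: "convex_on UNIV f"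
    and f_grad: "\<And>x. GDERIV f x :> gradf x"
    and f_C1: "continuous_on UNIV gradf"
    and f_lipschitz: "L-lipschitz_on UNIV gradf"
    and g_proper: "proper g"
    and g_convex: "ereal_convex g"
    and g_lsc: "lower_semicontinuous g"
    and theta: "\<And>x. \<theta> x = ereal (f x) + g x"
    and S_nonempty: "argmin_set \<theta> \<noteq> {}"
    and alpha: "\<alpha> \<ge> 3"
    and s_pos: "s > 0"
    and sL: "0 < s * L" "s * L \<le> 1"
    and rapg: "RAPG \<alpha> s gradf g y w"
  shows "(\<exists>r \<in> O(\<lambda>k. 1 / (real k)\<^sup>2).
            \<forall>\<^sub>F k in sequentially. \<theta> (w k) - (INF x. \<theta> x) = ereal (r k))
       \<and> (\<alpha> > 3 \<longrightarrow>
            (\<exists>r \<in> o(\<lambda>k. 1 / (real k)\<^sup>2).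
               \<forall>\<^sub>F k in sequentially. \<theta> (w k) - (INF x. \<theta> x) = ereal (r k))
          \<and> (\<exists>x \<in> argmin_set \<theta>. weakly_converges y x \<and> weakly_converges w x))"
proof -
  have ninf: "g x \<noteq> -\<infinity>" for x using g_proper by (simp add: proper_def)
  define D where "D = {x. g x \<noteq> \<infinity>}"
  define G where "G = (\<lambda>x. real_of_ereal (g x))"
  have G_convex: "convex_on D G" unfolding D_def G_def using g_convex ninf by (rule convex_on_domain)
  have cl: "closed {x \<in> D. G x + q x \<le> c}" if "continuous_on UNIV q" for q c
    using closed_sublevel_of_lsc[OF g_lsc ninf that, of c] by (simp add: D_def G_def)
  have theta_D: "\<theta> x = ereal (f x + G x)" if "x \<in> D" for x
    using that ninf[of x] theta[of x] by (cases "g x") (auto simp: D_def G_def)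
  have theta_nD: "\<theta> x = \<infinity>" if "x \<notin> D" for x using that theta[of x] by (simp add: D_def)
  have D_ne: "D \<noteq> {}" using g_proper by (auto simp: D_def proper_def)
  have argmin_iff: "z \<in> argmin_set \<theta> \<longleftrightarrow> z \<in> D \<and> (\<forall>x\<in>D. f z + G z \<le> f x + G x)" for z
  proof
    assume "z \<in> argmin_set \<theta>"
    then have min: "\<theta> z \<le> \<theta> x" for x by (simp add: argmin_set_def is_arg_min_def not_less)
    have "z \<in> D" using D_ne min theta_D theta_nD by (metis PInfty_neq_ereal(1) ereal_infty_less_eq(1) ex_in_conv)
    then show "z \<in> D \<and> (\<forall>x\<in>D. f z + G z \<le> f x + G x)" using min theta_D by (metis ereal_less_eq(3))
  next
    assume z: "z \<in> D \<and> (\<forall>x\<in>D. f z + G z \<le> f x + G x)"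
    have "\<theta> z \<le> \<theta> x" for x using z theta_D theta_nD by (cases "x \<in> D") auto
    then show "z \<in> argmin_set \<theta>" by (simp add: argmin_set_def is_arg_min_def not_less)
  qed
  obtain z where z: "z \<in> argmin_set \<theta>" using S_nonempty by blast
  then have zD: "z \<in> D" and z_min: "\<And>x. x \<in> D \<Longrightarrow> f z + G z \<le> f x + G x" by (auto simp: argmin_iff)
  (* optimality of z for f + G says that - gradf z is a subgradient of G at z *)
  have minorant: "(G z + inner (gradf z) z) + inner (- gradf z) u \<le> G u" if "u \<in> D" for u
  proof -
    have "G z \<le> G u + inner (gradf z) (u - z)"
    proof (rule minimizer_variational[OF G_convex zD that])
      show "f (z + t *\<^sub>R (u - z)) \<le> f z + t * inner (gradf z) (u - z) + t\<^sup>2 * (L / 2 * (norm (u - z))\<^sup>2)" for t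
        using descent_lemma[OF f_grad f_lipschitz, of z "t *\<^sub>R (u - z)"]
        by (simp add: power_mult_distrib mult_ac)
      show "G z + f z \<le> G x + f x" if "x \<in> D" for x using z_min[OF that] by simp
    qed
    then show ?thesis by (simp add: inner_diff_right)
  qed
  have "\<exists>w\<in>D. \<forall>u\<in>D. G w + 1 / (2 * s) * (norm (w - v))\<^sup>2 \<le> G u + 1 / (2 * s) * (norm (u - v))\<^sup>2" for v
    by (rule proximal_point_exists[OF G_convex D_ne s_pos _ minorant]) (intro cl continuous_intros)
  note prox = prox_characterization[OF ninf D_def G_def this]
  have w_prox: "w k = prox s g (y k - s *\<^sub>R gradf (y k))" for k
    using rapg s_pos by (cases "k = 0") (auto simp: RAPG_def T_op_def)
  have y_next: "y (Suc k) = w k + (1 - \<alpha> / (real k + 1)) *\<^sub>R (w k - w (k - 1))" if "k \<ge> 1" for k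
    using rapg that by (simp add: RAPG_def)
  define \<Phi> where "\<Phi> x = 2 * s * (f x + G x)" for x
  interpret ravine_iteration D \<Phi> y w \<alpha>
  proof
    have "convex_on D f" using f_convex G_convex by (auto intro: convex_on_subset simp: convex_on_def)
    then show "convex_on D \<Phi>"
      unfolding \<Phi>_def using G_convex s_pos by (intro convex_on_cmul convex_on_add) auto
    show "w k \<in> D" for k using prox(1) by (simp add: w_prox)
    show "\<Phi> (w k) + (norm (w k - x))\<^sup>2 \<le> \<Phi> x + (norm (y k - x))\<^sup>2" if "x \<in> D" for k x
      unfolding \<Phi>_def
      by (rule proximal_gradient_three_point[OF f_convex f_grad f_lipschitz G_convex s_pos sL(2) refl])
        (use prox that in \<open>auto simp: w_prox\<close>)
  qed (use y_next alpha in auto)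
  have minimizers_eq: "minimizers = argmin_set \<theta>"
    unfolding minimizers_def using s_pos by (auto simp: argmin_iff \<Phi>_def)
  define r where "r k = gap z k / (2 * s)" for k
  have "(INF x. \<theta> x) = \<theta> z"
    using z by (intro INF_eqI) (auto simp: argmin_set_def is_arg_min_def not_less)
  then have r: "\<theta> (w k) - (INF x. \<theta> x) = ereal (r k)" for k
    using s_pos by (simp add: theta_D w_in_D zD r_def gap_def \<Phi>_def field_simps)
  have z': "z \<in> minimizers" using z minimizers_eq by simp
  have "r \<in> O(\<lambda>k. 1 / (real k)\<^sup>2)"
  proof -
    obtain C where "\<forall>\<^sub>F k in sequentially. (real k)\<^sup>2 * gap z k \<le> C" using gap_bound[OF z'] by blast
    then have "\<forall>\<^sub>F k in sequentially. norm (r k) \<le> (C / (2 * s)) * norm (1 / (real k)\<^sup>2)"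
      using eventually_gt_at_top[of 0]
      by eventually_elim (use s_pos gap_nonneg[OF z'] in \<open>simp add: r_def field_simps\<close>)
    then show ?thesis by (rule bigoI)
  qed
  moreover have "r \<in> o(\<lambda>k. 1 / (real k)\<^sup>2)" if "\<alpha> > 3"
  proof (rule smalloI_tendsto)
    have "(\<lambda>k. ((real k)\<^sup>2 * gap z k) / (2 * s)) \<longlonglongrightarrow> 0 / (2 * s)"
      using s_pos by (intro tendsto_divide gap_little_o[OF that z'] tendsto_const) auto
    then show "(\<lambda>k. r k / (1 / (real k)\<^sup>2)) \<longlonglongrightarrow> 0" by (simp add: r_def mult_ac)
    show "\<forall>\<^sub>F k in sequentially. 1 / (real k)\<^sup>2 \<noteq> 0"
      using eventually_gt_at_top[of 0] by eventually_elim simp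
  qed
  moreover have "\<exists>x\<in>argmin_set \<theta>. weakly_converges y x \<and> weakly_converges w x" if "\<alpha> > 3"
  proof -
    have "{x \<in> D. \<Phi> x \<le> c} = {x \<in> D. G x + f x \<le> c / (2 * s)}" for c
      using s_pos by (auto simp: \<Phi>_def field_simps)
    moreover have "continuous_on UNIV f"
      using f_grad by (auto simp: continuous_on_eq_continuous_within gderiv_def intro: has_derivative_continuous)
    ultimately have "closed {x \<in> D. \<Phi> x \<le> c}" for c using cl by simp
    then show ?thesis using weak_convergence[OF that] z' minimizers_eq by auto
  qed
  ultimately show ?thesis using r by (intro conjI impI bexI[of _ r]) auto
qed

end
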